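(* Every bipartite graph is an induced subgraph of a bipartite squco graph. In particular, for every positive integer $k$ there exist squco graphs containing an induced path with at least $k$ vertices, and squco graphs containing an induced cycle of length at least $k$.
   Context: All graphs are finite and simple. The square $G^2$ of a graph $G$ has vertex set $V(G)$, and two distinct vertices are adjacent in $G^2$ if and only if their distance in $G$ is at most $2$. A graph $G$ is square-complementary (squco) if $G^2$ is isomorphic to the complement $\overline{G}$ of $G$. *)

theory Defs
  imports "Graph_Theory.Graph_Theory"
begin

text \<open>
  A finite simple graph is a \<open>pair_graph\<close>: a finite vertex set together with a symmetric,
  irreflexive set of arcs. An edge $uv$ is represented by the two arcs \<open>(u, v)\<close> and \<open>(v, u)\<close>.
\<close>

text \<open>The least length of a walk, every arc having weight 1; it is \<open>\<infinity>\<close> if there is no walk.\<close>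

definition gdist :: "'a pair_pre_digraph \<Rightarrow> 'a \<Rightarrow> 'a \<Rightarrow> ereal" where
  "gdist G u v = wf_digraph.\<mu> (with_proj G) (\<lambda>_. 1) u v"

definition square :: "'a pair_pre_digraph \<Rightarrow> 'a pair_pre_digraph" where
  "square G = \<lparr> pverts = pverts G,
     parcs = {(u, v) \<in> pverts G \<times> pverts G. u \<noteq> v \<and> gdist G u v \<le> 2} \<rparr>"

definition complement :: "'a pair_pre_digraph \<Rightarrow> 'a pair_pre_digraph" where
  "complement G = \<lparr> pverts = pverts G,
     parcs = {(u, v) \<in> pverts G \<times> pverts G. u \<noteq> v \<and> (u, v) \<notin> parcs G} \<rparr>"

definition isomorphic :: "'a pair_pre_digraph \<Rightarrow> 'b pair_pre_digraph \<Rightarrow> bool" where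
  "isomorphic G H \<longleftrightarrow> digraph_iso (with_proj G) (with_proj H)"

definition squco :: "'a pair_pre_digraph \<Rightarrow> bool" where
  "squco G \<longleftrightarrow> isomorphic (square G) (complement G)"

text \<open>One of the two colour classes may be empty.\<close>

definition bipartite :: "'a pair_pre_digraph \<Rightarrow> bool" where
  "bipartite G \<longleftrightarrow> (\<exists>U V. pverts G = U \<union> V \<and> U \<inter> V = {} \<and> parcs G \<subseteq> U \<times> V \<union> V \<times> U)"

text \<open>Being an induced subgraph is understood up to isomorphism, so the two vertex types may differ.\<close>

definition embeds_induced :: "'a pair_pre_digraph \<Rightarrow> 'b pair_pre_digraph \<Rightarrow> bool" where
  "embeds_induced G H \<longleftrightarrow>
     (\<exists>K. induced_subgraph (with_proj K) (with_proj H) \<and> isomorphic G K)"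

definition path_graph :: "nat \<Rightarrow> nat pair_pre_digraph" where
  "path_graph n = \<lparr> pverts = {..<n},
     parcs = {(i, j) \<in> {..<n} \<times> {..<n}. j = Suc i \<or> i = Suc j} \<rparr>"

text \<open>This is the cycle of length \<open>n\<close> only for \<open>n \<ge> 3\<close>.\<close>

definition cycle_graph :: "nat \<Rightarrow> nat pair_pre_digraph" where
  "cycle_graph n = \<lparr> pverts = {..<n},
     parcs = {(i, j) \<in> {..<n} \<times> {..<n}. j = Suc i mod n \<or> i = Suc j mod n} \<rparr>"

end

theory Submission
  imports Defs
begin

text \<open>
  If any two vertices on the same side of a bipartite graph have a common neighbour, then both
  \<open>G\<^sup>2\<close> and the complement of \<open>G\<close> consist of a clique on each side, joined by the edges of \<open>G\<close> and
  by the non-edges of \<open>G\<close> respectively. So \<open>G\<close> is squco as soon as some permutation of each side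
  exchanges edges and non-edges.

  For a relation \<open>A\<close> between rows and columns, take every row and every column twice, with a flag,
  and join the row \<open>(p, a)\<close> to the column \<open>(q, b)\<close> iff \<open>b\<close> holds (when \<open>A p q\<close>) or \<open>a\<close> holds
  (when \<open>\<not> A p q\<close>). Negating all flags exchanges edges and non-edges, the rows flagged \<open>False\<close> and
  the columns flagged \<open>True\<close> carry a copy of \<open>A\<close>, and a column \<open>(q, True)\<close> is a common
  neighbour of all rows \<open>(p, a)\<close> with \<open>A p q\<close>; dually for \<open>(p, True)\<close> and \<open>\<not> A p q\<close>. It remains
  to extend the given bipartite graph to a relation in which any two rows share a column of \<open>A\<close> and
  any two columns share a row of \<open>\<not> A\<close>. In the Fano plane any two points lie on a common line and
  any two lines miss a common point, and its incidence relation absorbs further rows and columns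
  that behave like copies of a fixed point and of a fixed line.
\<close>

section \<open>Distance two, isomorphisms and embeddings\<close>

lemma (in wf_digraph) awalk_cost_unit: "awalk_cost (\<lambda>_. 1) p = real (length p)"
  by (induction p) simp_all

text \<open>With unit weights the cost of a walk is its length, so only walks of length 1 or 2
  matter: the empty walk would force \<open>u = v\<close>.\<close>

lemma gdist_le_2_iff:
  assumes "pair_wf_digraph G" "u \<in> pverts G" "u \<noteq> v"
  shows "gdist G u v \<le> 2 \<longleftrightarrow>
    (u, v) \<in> parcs G \<or> (\<exists>w. (u, w) \<in> parcs G \<and> (w, v) \<in> parcs G)"
proof -
  interpret pair_wf_digraph G by fact
  have dist: "gdist G u v = (INF p\<in>{p. awalk u p v}. ereal (length p))"
    by (simp add: gdist_def \<mu>_def awalk_cost_unit)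
  have le: "gdist G u v \<le> ereal (length p)" if "awalk u p v" for p
    unfolding dist using that by (auto intro: INF_lower2)
  show ?thesis
  proof
    assume "gdist G u v \<le> 2"
    \<comment> \<open>A strict bound on the infimum yields an actual walk; as lengths are natural
      numbers, "below 3" is as good as "at most 2".\<close>
    also have "(2::ereal) < ereal 3" by simp
    finally obtain p where p: "awalk u p v" "length p < 3"
      unfolding dist by (auto simp: INF_less_iff)
    then consider "p = []" | e where "p = [e]" | e f where "p = [e, f]"
      by (auto simp: less_Suc_eq numeral_3_eq_3 length_Suc_conv)
    then show "(u, v) \<in> parcs G \<or> (\<exists>w. (u, w) \<in> parcs G \<and> (w, v) \<in> parcs G)"
      using p(1) assms(3) by cases (auto simp: awalk_def)
  next
    assume "(u, v) \<in> parcs G \<or> (\<exists>w. (u, w) \<in> parcs G \<and> (w, v) \<in> parcs G)"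
    then show "gdist G u v \<le> 2"
    proof
      assume "(u, v) \<in> parcs G"
      then have "awalk u [(u, v)] v" using assms(2) by (auto simp: awalk_def)
      from le[OF this] show ?thesis by (rule order_trans) simp
    next
      assume "\<exists>w. (u, w) \<in> parcs G \<and> (w, v) \<in> parcs G"
      then obtain w where "awalk u [(u, w), (w, v)] v"
        using assms(2) by (auto simp: awalk_def)
      from le[OF this] show ?thesis by simp
    qed
  qed
qed

text \<open>Arcs are pairs of vertices, so the vertex map alone determines the arc map
  \<open>map_prod f f\<close>, with \<open>fst\<close> and \<open>snd\<close> as tail and head of
  the target.\<close>

lemma isomorphicI:
  assumes "pair_wf_digraph G" "inj_on f (pverts G)"
    and "pverts H = f ` pverts G" "parcs H = map_prod f f ` parcs G"
  shows "isomorphic G H"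
proof -
  interpret pair_wf_digraph G by fact
  let ?h = "\<lparr>iso_verts = f, iso_arcs = map_prod f f, iso_head = snd, iso_tail = fst\<rparr>"
  have "inj_on (map_prod f f) (parcs G)"
    by (rule inj_on_subset[OF map_prod_inj_on[OF assms(2) assms(2)]])
      (auto dest: in_arcsD1 in_arcsD2)
  then have "digraph_isomorphism ?h"
    using assms(2) wf_digraph_axioms by (auto simp: digraph_isomorphism_def)
  moreover have "with_proj H = app_iso ?h (with_proj G)"
    by (simp add: app_iso_def with_proj_def assms(3,4))
  ultimately show ?thesis unfolding isomorphic_def digraph_iso_def by blast
qed

lemma embeds_inducedI:
  assumes "pair_wf_digraph G" "pair_wf_digraph H" "inj_on f (pverts G)"
    and "f ` pverts G \<subseteq> pverts H"
    and arcs: "\<And>u v. u \<in> pverts G \<Longrightarrow> v \<in> pverts G \<Longrightarrow>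
      (f u, f v) \<in> parcs H \<longleftrightarrow> (u, v) \<in> parcs G"
  shows "embeds_induced G H"
proof -
  interpret G: pair_wf_digraph G by fact
  let ?K = "\<lparr>pverts = f ` pverts G, parcs = map_prod f f ` parcs G\<rparr>"
  have "pair_wf_digraph ?K"
    by unfold_locales (auto dest: G.in_arcsD1 G.in_arcsD2)
  moreover have eq: "parcs ?K = {e \<in> parcs H. fst e \<in> pverts ?K \<and> snd e \<in> pverts ?K}"
  proof (intro set_eqI iffI)
    fix e assume "e \<in> parcs ?K"
    then obtain u v where "e = (f u, f v)" "(u, v) \<in> parcs G" by auto
    moreover from this have "u \<in> pverts G" "v \<in> pverts G"
      by (simp_all add: G.in_arcsD1[of u v] G.in_arcsD2[of u v])
    ultimately show "e \<in> {e \<in> parcs H. fst e \<in> pverts ?K \<and> snd e \<in> pverts ?K}"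
      using arcs[of u v] by simp
  next
    fix e assume "e \<in> {e \<in> parcs H. fst e \<in> pverts ?K \<and> snd e \<in> pverts ?K}"
    then have e: "fst e \<in> f ` pverts G" "snd e \<in> f ` pverts G" "e \<in> parcs H" by simp_all
    then obtain u v where uv: "u \<in> pverts G" "v \<in> pverts G" "e = (f u, f v)"
      by (metis imageE prod.collapse)
    then have "(u, v) \<in> parcs G" using e(3) arcs[of u v] by simp
    then show "e \<in> parcs ?K" using uv(3) by force
  qed
  ultimately have "induced_subgraph (with_proj ?K) (with_proj H)"
    using assms(2,4)
    by (intro induced_subgraphI subgraphI) (auto simp: compatible_def wf_digraph_wp_iff)
  then show ?thesis
    unfolding embeds_induced_def using isomorphicI[OF assms(1,3), of ?K] by auto
qed

lemma pair_graphI: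
  assumes "finite (pverts G)" "parcs G \<subseteq> pverts G \<times> pverts G" "sym (parcs G)" "irrefl (parcs G)"
  shows "pair_graph G"
proof unfold_locales
  show "finite (parcs G)"
    using assms(1,2) by (meson finite_SigmaI finite_subset)
qed (use assms in \<open>auto simp: symmetric_def irrefl_def\<close>)

section \<open>A squco criterion for bipartite graphs\<close>

lemma squco_if_bipartite_complement_iso:
  assumes "pair_wf_digraph G" "sym (parcs G)"
    and verts: "pverts G = U \<union> V" "U \<inter> V = {}" and arcs: "parcs G \<subseteq> U \<times> V \<union> V \<times> U"
    and U: "\<And>u u'. u \<in> U \<Longrightarrow> u' \<in> U \<Longrightarrow> \<exists>v. (u, v) \<in> parcs G \<and> (u', v) \<in> parcs G"
    and V: "\<And>v v'. v \<in> V \<Longrightarrow> v' \<in> V \<Longrightarrow> \<exists>u. (u, v) \<in> parcs G \<and> (u, v') \<in> parcs G"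
    and f: "bij_betw f U U" "bij_betw f V V"
    and flip: "\<And>u v. u \<in> U \<Longrightarrow> v \<in> V \<Longrightarrow> (f u, f v) \<in> parcs G \<longleftrightarrow> (u, v) \<notin> parcs G"
  shows "squco G"
proof -
  have s: "(x, y) \<in> parcs G \<longleftrightarrow> (y, x) \<in> parcs G" for x y
    using assms(2) by (meson symD)
  have bij: "bij_betw f (U \<union> V) (U \<union> V)"
    using bij_betw_combine[OF f] verts(2) by simp
  then have inj: "inj_on f (U \<union> V)" and img: "f ` (U \<union> V) = U \<union> V"
    by (auto simp: bij_betw_def)
  have fU: "f x \<in> U" if "x \<in> U" for x using f(1) that by (auto simp: bij_betw_def)
  have fV: "f x \<in> V" if "x \<in> V" for x using f(2) that by (auto simp: bij_betw_def)
  \<comment> \<open>On one side both statements are true: a common neighbour exists, and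
    \<open>f\<close> keeps the side, which spans no arcs. Across the sides a walk of two arcs is
    impossible, since it ends on the side where it starts; so only adjacency counts, and
    \<open>flip\<close> applies.\<close>
  have near: "gdist G x y \<le> 2 \<longleftrightarrow> (f x, f y) \<notin> parcs G"
    if "x \<in> U \<union> V" "y \<in> U \<union> V" "x \<noteq> y" for x y
  proof -
    have dist: "gdist G x y \<le> 2 \<longleftrightarrow>
        (x, y) \<in> parcs G \<or> (\<exists>w. (x, w) \<in> parcs G \<and> (w, y) \<in> parcs G)"
      using gdist_le_2_iff[OF assms(1), of x y] that verts(1) by auto
    consider "x \<in> U" "y \<in> U" | "x \<in> V" "y \<in> V" | "x \<in> U" "y \<in> V" | "x \<in> V" "y \<in> U"
      using \<open>x \<in> U \<union> V\<close> \<open>y \<in> U \<union> V\<close> by blast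
    then show ?thesis
    proof cases
      case 1
      then have "(f x, f y) \<notin> parcs G" using fU arcs verts(2) by blast
      with 1 show ?thesis unfolding dist using U[of x y] s[of y] by auto
    next
      case 2
      then have "(f x, f y) \<notin> parcs G" using fV arcs verts(2) by blast
      with 2 show ?thesis unfolding dist using V[of x y] s[of x] by auto
    next
      case 3
      then have "\<not> (\<exists>w. (x, w) \<in> parcs G \<and> (w, y) \<in> parcs G)" using arcs verts(2) by blast
      with 3 show ?thesis unfolding dist using flip[of x y] by blast
    next
      case 4
      then have "\<not> (\<exists>w. (x, w) \<in> parcs G \<and> (w, y) \<in> parcs G)" using arcs verts(2) by blast
      with 4 show ?thesis
        unfolding dist using flip[of y x] s[of x y] s[of "f x" "f y"] by blast
    qed
  qed
  have "isomorphic (square G) (complement G)"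
  proof (rule isomorphicI[where f = f])
    show "pair_wf_digraph (square G)" by unfold_locales (auto simp: square_def)
    show "inj_on f (pverts (square G))" using inj by (simp add: square_def verts)
    show "pverts (complement G) = f ` pverts (square G)"
      using img by (simp add: square_def complement_def verts)
    show "parcs (complement G) = map_prod f f ` parcs (square G)"
    proof (intro set_eqI iffI)
      fix e assume "e \<in> parcs (complement G)"
      then have e: "fst e \<in> f ` (U \<union> V)" "snd e \<in> f ` (U \<union> V)" "fst e \<noteq> snd e" "e \<notin> parcs G"
        unfolding img by (auto simp: complement_def verts)
      then obtain x y where xy: "x \<in> U \<union> V" "y \<in> U \<union> V" "e = (f x, f y)"
        by (metis imageE prod.collapse)
      then have "(x, y) \<in> parcs (square G)"
        using e near[of x y] by (auto simp: square_def verts)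
      then show "e \<in> map_prod f f ` parcs (square G)" using xy(3) by force
    next
      fix e assume "e \<in> map_prod f f ` parcs (square G)"
      then obtain x y where xy: "e = (f x, f y)" "(x, y) \<in> parcs (square G)" by auto
      then have "x \<in> U \<union> V" "y \<in> U \<union> V" "x \<noteq> y" "gdist G x y \<le> 2"
        by (auto simp: square_def verts)
      then show "e \<in> parcs (complement G)"
        using xy(1) near[of x y] img inj by (auto simp: complement_def verts inj_on_eq_iff)
    qed
  qed
  then show ?thesis by (simp add: squco_def)
qed

section \<open>The flagged double of a relation\<close>

text \<open>The leading Boolean of the code separates rows from columns, so one index may serve as
  both; coding into \<open>nat\<close> gives vertices of a fixed type.\<close>

definition row :: "'i::countable \<Rightarrow> bool \<Rightarrow> nat" where
  "row p a = to_nat (False, p, a)"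

definition col :: "'i::countable \<Rightarrow> bool \<Rightarrow> nat" where
  "col q b = to_nat (True, q, b)"

lemma row_col_simps [simp]:
  fixes p p' q q' :: "'i::countable"
  shows "row p a = row p' a' \<longleftrightarrow> p = p' \<and> a = a'"
  "col q b = col q' b' \<longleftrightarrow> q = q' \<and> b = b'"
  "row p a \<noteq> col q b" "col q b \<noteq> row p a"
  by (simp_all add: row_def col_def)

definition rows :: "'i::countable set \<Rightarrow> nat set" where
  "rows P = {row p a | p a. p \<in> P}"

definition cols :: "'i::countable set \<Rightarrow> nat set" where
  "cols Q = {col q b | q b. q \<in> Q}"

definition flagged_arcs :: "'i::countable set \<Rightarrow> 'i set \<Rightarrow> ('i \<Rightarrow> 'i \<Rightarrow> bool) \<Rightarrow> nat rel" where
  "flagged_arcs P Q A =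
     {(row p a, col q b) | p a q b. p \<in> P \<and> q \<in> Q \<and> (if A p q then b else a)}"

definition flagged_double ::
    "'i::countable set \<Rightarrow> 'i set \<Rightarrow> ('i \<Rightarrow> 'i \<Rightarrow> bool) \<Rightarrow> nat pair_pre_digraph" where
  "flagged_double P Q A = \<lparr>pverts = rows P \<union> cols Q,
     parcs = flagged_arcs P Q A \<union> (flagged_arcs P Q A)\<inverse>\<rparr>"

lemma row_in_rows_iff [simp]: "row p a \<in> rows P \<longleftrightarrow> p \<in> P"
  and col_in_cols_iff [simp]: "col q b \<in> cols Q \<longleftrightarrow> q \<in> Q"
  by (auto simp: rows_def cols_def)

lemma rows_cols_disjoint:
  fixes P Q :: "'i::countable set"
  shows "rows P \<inter> cols Q = {}"
  by (auto simp: rows_def cols_def)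

lemma parcs_flagged_double_subset:
  "parcs (flagged_double P Q A) \<subseteq> rows P \<times> cols Q \<union> cols Q \<times> rows P"
  by (force simp: flagged_double_def flagged_arcs_def rows_def cols_def)

lemma sym_flagged_double: "sym (parcs (flagged_double P Q A))"
  by (simp add: flagged_double_def sym_Un_converse)

lemma row_col_arc_iff:
  assumes "p \<in> P" "q \<in> Q"
  shows "(row p a, col q b) \<in> parcs (flagged_double P Q A) \<longleftrightarrow> (if A p q then b else a)"
    and "(col q b, row p a) \<in> parcs (flagged_double P Q A) \<longleftrightarrow> (if A p q then b else a)"
  using assms by (auto simp: flagged_double_def flagged_arcs_def)

lemma
  fixes P Q :: "'i::countable set" and p p' q q' :: 'i
  shows not_row_row_arc: "(row p a, row p' a') \<notin> parcs (flagged_double P Q A)"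
  and not_col_col_arc: "(col q b, col q' b') \<notin> parcs (flagged_double P Q A)"
  by (auto simp: flagged_double_def flagged_arcs_def)

lemma pair_graph_flagged_double:
  assumes "finite P" "finite Q"
  shows "pair_graph (flagged_double P Q A)"
proof (rule pair_graphI)
  show "finite (pverts (flagged_double P Q A))"
    using assms finite_image_set2[of "\<lambda>p. p \<in> P" "\<lambda>_. True" row]
      finite_image_set2[of "\<lambda>q. q \<in> Q" "\<lambda>_. True" col]
    by (simp add: flagged_double_def rows_def cols_def)
  show "parcs (flagged_double P Q A)
      \<subseteq> pverts (flagged_double P Q A) \<times> pverts (flagged_double P Q A)"
    using parcs_flagged_double_subset[of P Q A] by (auto simp: flagged_double_def)
  show "irrefl (parcs (flagged_double P Q A))"
    using parcs_flagged_double_subset[of P Q A] rows_cols_disjoint[of P Q]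
    by (auto simp: irrefl_def)
qed (rule sym_flagged_double)

lemma bipartite_flagged_double: "bipartite (flagged_double P Q A)"
  unfolding bipartite_def
  using parcs_flagged_double_subset[of P Q A] rows_cols_disjoint[of P Q]
  by (intro exI[of _ "rows P"] exI[of _ "cols Q"]) (simp add: flagged_double_def)

lemma squco_flagged_double:
  fixes P Q :: "'i::countable set"
  assumes "finite P" "finite Q"
    and P: "\<And>p p'. p \<in> P \<Longrightarrow> p' \<in> P \<Longrightarrow> \<exists>q\<in>Q. A p q \<and> A p' q"
    and Q: "\<And>q q'. q \<in> Q \<Longrightarrow> q' \<in> Q \<Longrightarrow> \<exists>p\<in>P. \<not> A p q \<and> \<not> A p q'"
  shows "squco (flagged_double P Q A)"
proof -
  interpret pair_graph "flagged_double P Q A"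
    by (rule pair_graph_flagged_double) fact+
  \<comment> \<open>Vertices are codes, so the flag is negated after decoding. On rows and columns
    this is an involution, hence \<open>f\<close> is its own inverse in the bijectivity proofs
    below.\<close>
  define f where "f x = (case from_nat x of (s::bool, i::'i, a) \<Rightarrow> to_nat (s, i, \<not> a))" for x
  have f: "f (row p a) = row p (\<not> a)" "f (col p a) = col p (\<not> a)" for p :: 'i and a
    by (simp_all add: f_def row_def col_def)
  show ?thesis
  proof (rule squco_if_bipartite_complement_iso[where U = "rows P" and V = "cols Q" and f = f])
    show "pair_wf_digraph (flagged_double P Q A)" by (fact pair_wf_digraph)
    show "pverts (flagged_double P Q A) = rows P \<union> cols Q" by (simp add: flagged_double_def)
    show "\<exists>v. (u, v) \<in> parcs (flagged_double P Q A) \<and> (u', v) \<in> parcs (flagged_double P Q A)"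
      if uu': "u \<in> rows P" "u' \<in> rows P" for u u'
    proof -
      obtain p a p' a' where u: "u = row p a" "u' = row p' a'" "p \<in> P" "p' \<in> P"
        using uu' unfolding rows_def by blast
      then obtain q where "q \<in> Q" "A p q" "A p' q" using P by blast
      with u show ?thesis by (intro exI[of _ "col q True"]) (simp add: row_col_arc_iff)
    qed
    show "\<exists>u. (u, v) \<in> parcs (flagged_double P Q A) \<and> (u, v') \<in> parcs (flagged_double P Q A)"
      if vv': "v \<in> cols Q" "v' \<in> cols Q" for v v'
    proof -
      obtain q b q' b' where v: "v = col q b" "v' = col q' b'" "q \<in> Q" "q' \<in> Q"
        using vv' unfolding cols_def by blast
      then obtain p where "p \<in> P" "\<not> A p q" "\<not> A p q'" using Q by blast
      with v show ?thesis by (intro exI[of _ "row p True"]) (simp add: row_col_arc_iff)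
    qed
    show "bij_betw f (rows P) (rows P)"
      by (rule bij_betw_byWitness[where f' = f]) (auto simp: rows_def f)
    show "bij_betw f (cols Q) (cols Q)"
      by (rule bij_betw_byWitness[where f' = f]) (auto simp: cols_def f)
    show "(f u, f v) \<in> parcs (flagged_double P Q A) \<longleftrightarrow> (u, v) \<notin> parcs (flagged_double P Q A)"
      if "u \<in> rows P" "v \<in> cols Q" for u v
      using that by (auto simp: rows_def cols_def f row_col_arc_iff split: if_splits)
  qed (fact sym_flagged_double rows_cols_disjoint parcs_flagged_double_subset)+
qed

lemma embeds_induced_flagged_double:
  assumes G: "pair_graph G" "pverts G = U \<union> V" "U \<inter> V = {}" "parcs G \<subseteq> U \<times> V \<union> V \<times> U"
    and fin: "finite P" "finite Q"
    and g: "inj_on g (pverts G)" "g ` U \<subseteq> P" "g ` V \<subseteq> Q"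
    and A: "\<And>u v. u \<in> U \<Longrightarrow> v \<in> V \<Longrightarrow> A (g u) (g v) \<longleftrightarrow> (u, v) \<in> parcs G"
  shows "embeds_induced G (flagged_double P Q A)"
proof -
  interpret G: pair_graph G by fact
  interpret H: pair_graph "flagged_double P Q A" by (rule pair_graph_flagged_double) fact+
  \<comment> \<open>With these flags, \<open>if A p q then b else a\<close> reduces to
    \<open>A p q\<close>.\<close>
  define h where "h x = (if x \<in> U then row (g x) False else col (g x) True)" for x
  have hU: "h x = row (g x) False" "g x \<in> P" if "x \<in> U" for x
    using that g(2) by (auto simp: h_def)
  have hV: "h x = col (g x) True" "g x \<in> Q" if "x \<in> V" for x
    using that G(3) g(3) by (auto simp: h_def)
  show ?thesis
  proof (rule embeds_inducedI[where f = h])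
    show "pair_wf_digraph G" "pair_wf_digraph (flagged_double P Q A)"
      by (fact G.pair_wf_digraph H.pair_wf_digraph)+
    show "inj_on h (pverts G)"
    proof (rule inj_onI)
      fix x y assume "x \<in> pverts G" "y \<in> pverts G" "h x = h y"
      moreover from this have "g x = g y" by (simp add: h_def split: if_splits)
      ultimately show "x = y" using g(1) by (simp add: inj_onD)
    qed
    show "h ` pverts G \<subseteq> pverts (flagged_double P Q A)"
    proof (rule image_subsetI)
      fix x assume "x \<in> pverts G"
      then have "x \<in> U \<or> x \<in> V" by (simp add: G(2))
      then have "h x \<in> rows P \<union> cols Q" by (elim disjE) (simp_all add: hU hV)
      then show "h x \<in> pverts (flagged_double P Q A)" by (simp add: flagged_double_def)
    qed
    show "(h x, h y) \<in> parcs (flagged_double P Q A) \<longleftrightarrow> (x, y) \<in> parcs G"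
      if xy: "x \<in> pverts G" "y \<in> pverts G" for x y
    proof -
      consider "x \<in> U" "y \<in> U" | "x \<in> V" "y \<in> V" | "x \<in> U" "y \<in> V" | "x \<in> V" "y \<in> U"
        using xy unfolding G(2) by blast
      then show ?thesis
      proof cases
        case 1
        then have "(x, y) \<notin> parcs G" using G(3,4) by blast
        with 1 show ?thesis by (simp add: hU not_row_row_arc)
      next
        case 2
        then have "(x, y) \<notin> parcs G" using G(3,4) by blast
        with 2 show ?thesis by (simp add: hV not_col_col_arc)
      next
        case 3
        then show ?thesis by (simp add: hU hV row_col_arc_iff A)
      next
        case 4
        then have "(y, x) \<in> parcs G \<longleftrightarrow> (x, y) \<in> parcs G" by (metis G.arcs_symmetric)
        with 4 show ?thesis by (simp add: hU hV row_col_arc_iff A)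
      qed
    qed
  qed
qed

section \<open>The Fano plane\<close>

text \<open>\<open>{0, 1, 3}\<close> is a perfect difference set modulo 7.\<close>

definition fano :: "nat \<Rightarrow> nat \<Rightarrow> bool" where
  "fano p q \<longleftrightarrow> (p + q) mod 7 \<in> {0, 1, 3}"

lemma lessThan_7: "{..<7::nat} = {0, 1, 2, 3, 4, 5, 6}"
  by auto

text \<open>Every residue modulo 7 is a difference of two elements of \<open>{0, 1, 3}\<close>. If
  \<open>d - d'\<close> is congruent to \<open>p - p'\<close>, then \<open>q\<close> congruent to
  \<open>d - p\<close> works. Here the finitely many cases are simply evaluated.\<close>

lemma fano_common_line: "\<forall>p\<in>{..<7}. \<forall>p'\<in>{..<7}. \<exists>q\<in>{..<7}. fano p q \<and> fano p' q"
  unfolding lessThan_7 by (simp add: fano_def)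

text \<open>Each line has three points, so two lines cover at most six of the seven points.\<close>

lemma fano_common_nonpoint: "\<forall>q\<in>{..<7}. \<forall>q'\<in>{..<7}. \<exists>p\<in>{..<7}. \<not> fano p q \<and> \<not> fano p q'"
  unfolding lessThan_7 by (simp add: fano_def)

text \<open>The \<open>Inr\<close>-\<open>Inr\<close> block is reserved for the given bipartite
  graph. It can be arbitrary because the witnesses for both covering conditions are taken from the
  Fano part.\<close>

fun fano_extension :: "(nat \<Rightarrow> nat \<Rightarrow> bool) \<Rightarrow> nat + nat \<Rightarrow> nat + nat \<Rightarrow> bool" where
  "fano_extension R (Inl p) (Inl q) = fano p q"
| "fano_extension R (Inl p) (Inr n) = fano p 0"
| "fano_extension R (Inr m) (Inl q) = fano 0 q"
| "fano_extension R (Inr m) (Inr n) = R m n"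

lemma fano_extension_common_col:
  assumes "x \<in> {..<7} <+> M" "y \<in> {..<7} <+> M"
  shows "\<exists>z\<in>{..<7} <+> N. fano_extension R x z \<and> fano_extension R y z"
proof -
  \<comment> \<open>Towards Fano columns, each row acts like the point \<open>r\<close> assigns to
    it: itself, or 0 for an added row.\<close>
  define r :: "nat + nat \<Rightarrow> nat" where "r = case_sum id (\<lambda>_. 0)"
  have r: "fano_extension R w (Inl q) = fano (r w) q" for w q by (cases w) (simp_all add: r_def)
  have "r x \<in> {..<7}" "r y \<in> {..<7}" using assms by (auto simp: r_def)
  then obtain q where "q \<in> {..<7}" "fano (r x) q" "fano (r y) q" using fano_common_line by blast
  then show ?thesis by (intro bexI[of _ "Inl q"]) (auto simp: r)
qed

lemma fano_extension_common_nonrow: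
  assumes "x \<in> {..<7} <+> N" "y \<in> {..<7} <+> N"
  shows "\<exists>z\<in>{..<7} <+> M. \<not> fano_extension R z x \<and> \<not> fano_extension R z y"
proof -
  define r :: "nat + nat \<Rightarrow> nat" where "r = case_sum id (\<lambda>_. 0)"
  have r: "fano_extension R (Inl p) w = fano p (r w)" for w p by (cases w) (simp_all add: r_def)
  have "r x \<in> {..<7}" "r y \<in> {..<7}" using assms by (auto simp: r_def)
  then obtain p where "p \<in> {..<7}" "\<not> fano p (r x)" "\<not> fano p (r y)"
    using fano_common_nonpoint by blast
  then show ?thesis by (intro bexI[of _ "Inl p"]) (auto simp: r)
qed

section \<open>Embedding an arbitrary bipartite graph\<close>

lemma bipartite_embeds_in_bipartite_squco:
  fixes G :: "'a pair_pre_digraph"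
  assumes "pair_graph G" "bipartite G"
  shows "\<exists>H :: nat pair_pre_digraph.
    pair_graph H \<and> bipartite H \<and> squco H \<and> embeds_induced G H"
proof -
  interpret pair_graph G by fact
  obtain U V where UV: "pverts G = U \<union> V" "U \<inter> V = {}" "parcs G \<subseteq> U \<times> V \<union> V \<times> U"
    using assms(2) unfolding bipartite_def by blast
  have fin: "finite U" "finite V" using pair_finite_verts by (simp_all add: UV)
  \<comment> \<open>The type \<open>'a\<close> need not be countable, but the finite vertex set can
    be numbered.\<close>
  obtain c :: "'a \<Rightarrow> nat" where c: "inj_on c (pverts G)"
    using finite_imp_inj_to_nat_seg[OF pair_finite_verts] by blast
  define A where "A = fano_extension (\<lambda>m n. (m, n) \<in> map_prod c c ` parcs G)"
  define P Q where "P = {..<7::nat} <+> c ` U" and "Q = {..<7::nat} <+> c ` V"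
  have PQ: "finite P" "finite Q" using fin by (simp_all add: P_def Q_def)
  have "embeds_induced G (flagged_double P Q A)"
  proof (rule embeds_induced_flagged_double[where g = "Inr \<circ> c", OF assms(1) UV PQ])
    show "inj_on (Inr \<circ> c) (pverts G)" using c by (auto simp: inj_on_def)
    show "(Inr \<circ> c) ` U \<subseteq> P" "(Inr \<circ> c) ` V \<subseteq> Q" by (auto simp: P_def Q_def)
    show "A ((Inr \<circ> c) u) ((Inr \<circ> c) v) \<longleftrightarrow> (u, v) \<in> parcs G" if "u \<in> U" "v \<in> V" for u v
    proof -
      have "parcs G \<subseteq> pverts G \<times> pverts G" using in_arcsD1 in_arcsD2 by auto
      moreover have "(u, v) \<in> pverts G \<times> pverts G" using that by (simp add: UV(1))
      ultimately have "map_prod c c (u, v) \<in> map_prod c c ` parcs G \<longleftrightarrow> (u, v) \<in> parcs G"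
        by (intro inj_on_image_mem_iff[OF map_prod_inj_on[OF c c]])
      then show ?thesis by (simp add: A_def)
    qed
  qed
  moreover have "squco (flagged_double P Q A)"
    using fano_extension_common_col fano_extension_common_nonrow
    by (intro squco_flagged_double PQ) (simp_all only: P_def Q_def A_def)
  ultimately show ?thesis
    using pair_graph_flagged_double[OF PQ] bipartite_flagged_double by blast
qed

section \<open>Paths and even cycles\<close>

lemma bipartite_by_parity:
  fixes G :: "nat pair_pre_digraph"
  assumes "parcs G \<subseteq> pverts G \<times> pverts G" "\<And>i j. (i, j) \<in> parcs G \<Longrightarrow> even i \<longleftrightarrow> odd j"
  shows "bipartite G"
  unfolding bipartite_def
  using assms by (intro exI[of _ "{i \<in> pverts G. even i}"] exI[of _ "{i \<in> pverts G. odd i}"]) blast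

lemma pair_graph_path_graph: "pair_graph (path_graph n)"
  by (rule pair_graphI) (auto simp: path_graph_def sym_def irrefl_def)

lemma bipartite_path_graph: "bipartite (path_graph n)"
  by (rule bipartite_by_parity) (auto simp: path_graph_def)

lemma pair_graph_cycle_graph:
  assumes "n \<ge> 2"
  shows "pair_graph (cycle_graph n)"
proof (rule pair_graphI)
  \<comment> \<open>For \<open>n = 1\<close> the vertex 0 would be its own successor, giving a
    loop.\<close>
  have "Suc i mod n \<noteq> i" if "i < n" for i
    using that assms by (cases "Suc i = n") auto
  then show "irrefl (parcs (cycle_graph n))" by (force simp: cycle_graph_def irrefl_def)
qed (auto simp: cycle_graph_def sym_def)

lemma bipartite_cycle_graph:
  assumes "even n"
  shows "bipartite (cycle_graph n)"
proof (rule bipartite_by_parity)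
  \<comment> \<open>Reduction modulo an even number preserves parity, so the closing edge from
    \<open>n - 1\<close> to 0 also changes parity.\<close>
  have "even (Suc i mod n) \<longleftrightarrow> odd i" for i
    using assms by (simp add: dvd_mod_iff)
  then show "even i \<longleftrightarrow> odd j" if "(i, j) \<in> parcs (cycle_graph n)" for i j
    using that by (auto simp: cycle_graph_def)
qed (auto simp: cycle_graph_def)

theorem theorem4p1:
  shows "(\<forall>G :: 'a pair_pre_digraph. pair_graph G \<and> bipartite G \<longrightarrow>
            (\<exists>H :: nat pair_pre_digraph.
               pair_graph H \<and> bipartite H \<and> squco H \<and> embeds_induced G H)) \<and>
         (\<forall>k :: nat. k \<ge> 1 \<longrightarrow>
            (\<exists>H :: nat pair_pre_digraph. pair_graph H \<and> squco H \<and>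
               (\<exists>n \<ge> k. embeds_induced (path_graph n) H)) \<and>
            (\<exists>H :: nat pair_pre_digraph. pair_graph H \<and> squco H \<and>
               (\<exists>n \<ge> k. n \<ge> 3 \<and> embeds_induced (cycle_graph n) H)))"
proof (intro conjI allI impI)
  fix G :: "'a pair_pre_digraph" assume "pair_graph G \<and> bipartite G"
  then show "\<exists>H :: nat pair_pre_digraph.
      pair_graph H \<and> bipartite H \<and> squco H \<and> embeds_induced G H"
    using bipartite_embeds_in_bipartite_squco by blast
next
  fix k :: nat
  show "\<exists>H :: nat pair_pre_digraph. pair_graph H \<and> squco H \<and>
      (\<exists>n \<ge> k. embeds_induced (path_graph n) H)"
    using bipartite_embeds_in_bipartite_squco[OF pair_graph_path_graph bipartite_path_graph, of k]
    by blast
next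
  fix k :: nat
  \<comment> \<open>The length \<open>2 * k + 4\<close> is even, so that the cycle is bipartite, and
    meets both lower bounds.\<close>
  have "2 * k + 4 \<ge> k" "2 * k + 4 \<ge> 3" by simp_all
  moreover have "pair_graph (cycle_graph (2 * k + 4))" "bipartite (cycle_graph (2 * k + 4))"
    by (simp_all add: pair_graph_cycle_graph bipartite_cycle_graph)
  ultimately show "\<exists>H :: nat pair_pre_digraph. pair_graph H \<and> squco H \<and>
      (\<exists>n \<ge> k. n \<ge> 3 \<and> embeds_induced (cycle_graph n) H)"
    using bipartite_embeds_in_bipartite_squco[of "cycle_graph (2 * k + 4)"] by blast
qed

end
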